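(* For each integer $n\ge1$ let $F_n$ be the expected value of the position $f(\sigma)$ of the first match, where $\sigma$ is chosen uniformly at random from $M_n$. Then $F_n\sim\sqrt{\pi n}$ as $n\to\infty$, i.e. $\lim_{n\to\infty}F_n/\sqrt{\pi n}=1$.
   Context: For $n\ge1$, $M_n$ denotes the set of standard permutations (deals) of the multiset $\{1,1,2,2,\dots,n,n\}$: functions $\sigma:\{1,\dots,2n\}\to\{1,\dots,n\}$ taking each value exactly twice and such that, for each $1\le i\le n-1$, the second occurrence of $i$ in the sequence $\sigma(1),\dots,\sigma(2n)$ is to the left of the second occurrence of $i+1$. For $\sigma\in M_n$, $f(\sigma)$ (the position of the first match) is the smallest index $j$ such that $\sigma(j)=\sigma(i)$ for some $i<j$. *)

theory Defs
  imports "HOL-Probability.Probability"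
begin

text \<open>Deals are extensional functions on \<open>{1..2*n}\<close>, so that each sequence of length
  \<open>2*n\<close> is represented by exactly one HOL function.\<close>

definition second_occurrence :: "nat \<Rightarrow> (nat \<Rightarrow> nat) \<Rightarrow> nat \<Rightarrow> nat" where
  "second_occurrence n \<sigma> i =
     (THE j. j \<in> {1..2*n} \<and> \<sigma> j = i \<and> (\<exists>k\<in>{1..<j}. \<sigma> k = i))"

definition standard_deals :: "nat \<Rightarrow> (nat \<Rightarrow> nat) set" where
  "standard_deals n =
     {\<sigma> \<in> {1..2*n} \<rightarrow>\<^sub>E {1..n}.
        (\<forall>i\<in>{1..n}. card {j \<in> {1..2*n}. \<sigma> j = i} = 2) \<and>
        (\<forall>i\<in>{1..<n}. second_occurrence n \<sigma> i < second_occurrence n \<sigma> (i + 1))}"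

definition first_match :: "nat \<Rightarrow> (nat \<Rightarrow> nat) \<Rightarrow> nat" where
  "first_match n \<sigma> = (LEAST j. j \<in> {1..2*n} \<and> (\<exists>i\<in>{1..<j}. \<sigma> j = \<sigma> i))"

definition expected_first_match :: "nat \<Rightarrow> real" where
  "expected_first_match n =
     measure_pmf.expectation (pmf_of_set (standard_deals n)) (\<lambda>\<sigma>. real (first_match n \<sigma>))"

text \<open>\<open>pmf_of_set\<close> is the uniform distribution only on finite nonempty sets, and
  \<open>THE\<close> and \<open>LEAST\<close> need witnesses; the following facts discharge these conditions.\<close>

lemma finite_standard_deals: "finite (standard_deals n)"
  by (rule finite_subset[of _ "{1..2*n} \<rightarrow>\<^sub>E {1..n}"])
     (auto simp: standard_deals_def intro: finite_PiE)

lemma second_occurrence_unique: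
  fixes n :: nat and \<sigma> :: "nat \<Rightarrow> nat"
  assumes "card {j \<in> {1..2*n}. \<sigma> j = i} = 2"
  shows "\<exists>!j. j \<in> {1..2*n} \<and> \<sigma> j = i \<and> (\<exists>k\<in>{1..<j}. \<sigma> k = i)"
proof -
  obtain a b where ab: "{j \<in> {1..2*n}. \<sigma> j = i} = {a, b}" "a < b"
  proof -
    obtain x y where "{j \<in> {1..2*n}. \<sigma> j = i} = {x, y}" "x \<noteq> y"
      using assms by (auto simp: card_2_iff)
    then show ?thesis
      using that[of x y] that[of y x] by (metis insert_commute linorder_neqE_nat)
  qed
  have mem: "j \<in> {1..2*n} \<and> \<sigma> j = i \<longleftrightarrow> j = a \<or> j = b" for j
    using ab(1) by blast
  show ?thesis
  proof (rule ex1I[of _ b])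
    show "b \<in> {1..2*n} \<and> \<sigma> b = i \<and> (\<exists>k\<in>{1..<b}. \<sigma> k = i)"
      using mem[of a] mem[of b] ab(2) by auto
  next
    fix j assume j: "j \<in> {1..2*n} \<and> \<sigma> j = i \<and> (\<exists>k\<in>{1..<j}. \<sigma> k = i)"
    then obtain k where k: "k \<in> {1..<j}" "\<sigma> k = i" by blast
    then have "k \<in> {1..2*n}" using j by auto
    then have "k = a \<or> k = b" using mem[of k] k by blast
    moreover have "j = a \<or> j = b" using mem[of j] j by blast
    ultimately show "j = b" using k ab(2) by auto
  qed
qed

lemma standard_deals_nonempty: "standard_deals n \<noteq> {}"
proof -
  define \<sigma> where "\<sigma> = (\<lambda>j\<in>{1..2*n}. (j + 1) div 2)"
  have two: "{j \<in> {1..2*n}. \<sigma> j = i} = {2*i - 1, 2*i}" if "i \<in> {1..n}" for i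
    using that by (auto simp: \<sigma>_def)
  have card: "card {j \<in> {1..2*n}. \<sigma> j = i} = 2" if "i \<in> {1..n}" for i
    unfolding two[OF that] using that by (subst card_insert_disjoint) auto
  have so: "second_occurrence n \<sigma> i = 2*i" if "i \<in> {1..n}" for i
    unfolding second_occurrence_def
  proof (rule the1_equality[OF second_occurrence_unique[OF card[OF that]]])
    have "2*i - 1 \<in> {1..<2*i}" using that by auto
    moreover have "\<sigma> (2*i - 1) = i" "\<sigma> (2*i) = i" using two[OF that] by auto
    ultimately show "2*i \<in> {1..2*n} \<and> \<sigma> (2*i) = i \<and> (\<exists>k\<in>{1..<2*i}. \<sigma> k = i)"
      using that by auto
  qed
  have "\<sigma> \<in> {1..2*n} \<rightarrow>\<^sub>E {1..n}"
    by (auto simp: \<sigma>_def)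
  then have "\<sigma> \<in> standard_deals n"
    using card so by (simp add: standard_deals_def)
  then show ?thesis by blast
qed

lemma first_match_exists:
  assumes "n \<ge> 1" "\<sigma> \<in> standard_deals n"
  shows "\<exists>j. j \<in> {1..2*n} \<and> (\<exists>i\<in>{1..<j}. \<sigma> j = \<sigma> i)"
proof -
  have "card {j \<in> {1..2*n}. \<sigma> j = 1} = 2"
    using assms by (auto simp: standard_deals_def)
  from second_occurrence_unique[OF this] show ?thesis by metis
qed

end

theory Submission
  imports Defs "HOL-Real_Asymp.Real_Asymp"
begin

text \<open>In a standard deal of size \<open>n + 1\<close> the last card is the second copy of \<open>n + 1\<close>, so deals of
  size \<open>n + 1\<close> arise bijectively from a deal \<open>\<sigma>\<close> of size \<open>n\<close> by appending \<open>n + 1\<close> and inserting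
  its first copy at one of the positions \<open>p = 1, \<dots>, 2n + 1\<close>. This moves the first match \<open>f\<close> of
  \<open>\<sigma>\<close> to \<open>f + 1\<close> if \<open>p \<le> f\<close>, and leaves it in place otherwise. Summing over \<open>p\<close> gives
  \<open>f (f + 1) + (2n + 1 - f) f = (2n + 2) f\<close>, hence \<open>F (n + 1) = (2n + 2) / (2n + 1) * F n\<close>, and
  \<open>(F n)\<^sup>2\<close> is \<open>2n + 1\<close> times the \<open>n\<close>-th partial product of Wallis' product for \<open>\<pi> / 2\<close>.\<close>

section \<open>Positions of a value, and the last card of a deal\<close>

definition occurrences :: "nat \<Rightarrow> (nat \<Rightarrow> nat) \<Rightarrow> nat \<Rightarrow> nat set" where
  "occurrences n \<sigma> i = {j \<in> {1..2*n}. \<sigma> j = i}"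

lemma finite_occurrences [simp]: "finite (occurrences n \<sigma> i)"
  by (simp add: occurrences_def)

text \<open>Of two positions, only the larger has the other to its left. Unlike the
  \<open>THE\<close> description, a maximum can be transported along a monotone map of
  positions.\<close>

lemma second_occurrence_eq_Max:
  assumes "card (occurrences n \<sigma> i) = 2"
  shows "second_occurrence n \<sigma> i = Max (occurrences n \<sigma> i)"
proof -
  let ?A = "occurrences n \<sigma> i"
  have ne: "?A \<noteq> {}" using assms by auto
  have M: "Max ?A \<in> ?A" by (rule Max_in) (use ne in auto)
  have "card (?A - {Max ?A}) = 1" using assms M by simp
  then obtain k where k: "k \<in> ?A" "k \<noteq> Max ?A" by (metis card_1_singletonE DiffE insertI1)
  then have "k < Max ?A" by (simp add: order_neq_le_trans)
  then have "Max ?A \<in> {1..2*n} \<and> \<sigma> (Max ?A) = i \<and> (\<exists>k\<in>{1..<Max ?A}. \<sigma> k = i)"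
    using M k by (auto simp: occurrences_def)
  then show ?thesis
    using second_occurrence_unique[OF assms[unfolded occurrences_def]]
    unfolding second_occurrence_def by (intro the1_equality)
qed

text \<open>The two order conditions are compared only under the cardinality condition, which is
  what identifies second occurrences with maxima.\<close>

lemma standard_deals_iff:
  "\<sigma> \<in> standard_deals n \<longleftrightarrow>
     \<sigma> \<in> {1..2*n} \<rightarrow>\<^sub>E {1..n} \<and>
     (\<forall>i\<in>{1..n}. card (occurrences n \<sigma> i) = 2) \<and>
     (\<forall>i\<in>{1..<n}. Max (occurrences n \<sigma> i) < Max (occurrences n \<sigma> (i + 1)))"
proof -
  let ?A = "occurrences n \<sigma>"
  have "(\<forall>i\<in>{1..<n}. second_occurrence n \<sigma> i < second_occurrence n \<sigma> (i + 1)) \<longleftrightarrow>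
      (\<forall>i\<in>{1..<n}. Max (?A i) < Max (?A (i + 1)))" if "\<forall>i\<in>{1..n}. card (?A i) = 2"
    using that by (intro ball_cong refl) (simp add: second_occurrence_eq_Max)
  then show ?thesis
    unfolding standard_deals_def occurrences_def[symmetric] by blast
qed

text \<open>The maxima increase with the value, so a value \<open>v < n\<close> at position
  \<open>2*n\<close> would force the maximum for \<open>n\<close> beyond \<open>2*n\<close>.\<close>

lemma last_card:
  assumes "\<sigma> \<in> standard_deals n" "n \<ge> 1"
  shows "\<sigma> (2*n) = n"
proof (rule ccontr)
  assume ne: "\<sigma> (2*n) \<noteq> n"
  let ?A = "occurrences n \<sigma>"
  define v where "v = \<sigma> (2*n)"
  have "v \<in> {1..n}" using assms unfolding v_def standard_deals_iff by (auto dest: PiE_mem)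
  then have v: "1 \<le> v" "v < n" using ne by (auto simp: v_def)
  have step: "Max (?A i) < Max (?A (Suc i))" if "1 \<le> i" "i < n" for i
    using assms that by (auto simp: standard_deals_iff)
  \<comment> \<open>Downward induction from \<open>n\<close>. The guard is carried along because the
    induction also passes through \<open>0\<close>, where the order condition says nothing.\<close>
  have "1 \<le> v \<longrightarrow> Max (?A v) < Max (?A n)"
    using \<open>v < n\<close>
  proof (induction rule: strict_inc_induct)
    case (base i)
    then show ?case using step[of i] by auto
  next
    case (step i)
    then show ?case using \<open>\<And>i. 1 \<le> i \<Longrightarrow> i < n \<Longrightarrow> Max (?A i) < Max (?A (Suc i))\<close>[of i] by auto
  qed
  moreover have "2*n \<le> Max (?A v)"
    by (rule Max_ge) (use assms in \<open>auto simp: occurrences_def v_def\<close>)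
  moreover have "Max (?A n) \<le> 2*n"
  proof -
    have "card (?A n) = 2" using assms by (simp add: standard_deals_iff)
    then have "Max (?A n) \<in> ?A n" by (intro Max_in) auto
    then show ?thesis by (simp add: occurrences_def)
  qed
  ultimately show False using v by linarith
qed

section \<open>The gap map \<open>skip p\<close>: where an old position moves when a card is
  inserted at \<open>p\<close>\<close>

definition skip :: "nat \<Rightarrow> nat \<Rightarrow> nat" where
  "skip p j = (if j < p then j else j + 1)"

lemma strict_mono_skip: "strict_mono (skip p)"
  by (auto simp: strict_mono_def skip_def)

lemma skip_image:
  assumes "p \<in> {1..m+1}"
  shows "skip p ` {1..m} = {1..m+1} - {p}"
proof (intro equalityI subsetI)
  fix j assume j: "j \<in> {1..m+1} - {p}"
  then have "j = skip p (if j < p then j else j - 1)" by (auto simp: skip_def)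
  then show "j \<in> skip p ` {1..m}"
    by (rule image_eqI) (use j assms in auto)
qed (use assms in \<open>auto simp: skip_def\<close>)

text \<open>Exactly the gaps \<open>p\<close> in \<open>{1..f}\<close> push \<open>f\<close> up by
  one, and all of them lie in \<open>{1..m}\<close>, so the total is
  \<open>m * f + f\<close>.\<close>

lemma sum_skip:
  assumes "f \<le> m"
  shows "(\<Sum>p\<in>{1..m}. skip p f) = (m + 1) * f"
proof -
  have "(\<Sum>p\<in>{1..m}. skip p f) = (\<Sum>p\<in>{1..m}. f + (if p \<in> {1..f} then 1 else 0))"
    by (intro sum.cong) (auto simp: skip_def)
  also have "\<dots> = m * f + card ({1..m} \<inter> {1..f})"
    by (simp only: sum.distrib sum.inter_restrict[symmetric] finite_atLeastAtMost) simp
  also have "{1..m} \<inter> {1..f} = {1..f}" using assms by auto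
  finally show ?thesis by simp
qed

section \<open>Inserting and deleting the two cards of the top value\<close>

definition insert_pair :: "nat \<Rightarrow> nat \<Rightarrow> (nat \<Rightarrow> nat) \<Rightarrow> nat \<Rightarrow> nat" where
  "insert_pair n p \<sigma> = (\<lambda>j\<in>{1..2*Suc n}.
     if j = p \<or> j = 2*n+2 then Suc n else if j < p then \<sigma> j else \<sigma> (j - 1))"

text \<open>Stopping at \<open>j = 2*n\<close> also drops the last card, since
  \<open>skip p j\<close> is then at most \<open>2*n+1\<close>.\<close>

definition delete_pair :: "nat \<Rightarrow> nat \<Rightarrow> (nat \<Rightarrow> nat) \<Rightarrow> nat \<Rightarrow> nat" where
  "delete_pair n p \<tau> = (\<lambda>j\<in>{1..2*n}. \<tau> (skip p j))"

lemma occurrences_delete_pair: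
  assumes "p \<in> {1..2*n+1}" "occurrences (Suc n) \<tau> (Suc n) = {p, 2*n+2}" "i \<noteq> Suc n"
  shows "occurrences (Suc n) \<tau> i = skip p ` occurrences n (delete_pair n p \<tau>) i"
proof -
  have "p \<in> occurrences (Suc n) \<tau> (Suc n)" "2*n+2 \<in> occurrences (Suc n) \<tau> (Suc n)"
    unfolding assms(2) by auto
  then have last: "\<tau> p = Suc n" "\<tau> (2*n+2) = Suc n" by (auto simp: occurrences_def)
  have "occurrences (Suc n) \<tau> i = {j \<in> {1..2*n+1} - {p}. \<tau> j = i}"
    using last assms(3) by (auto simp: occurrences_def le_Suc_eq)
  also have "\<dots> = skip p ` {j \<in> {1..2*n}. \<tau> (skip p j) = i}"
    unfolding skip_image[OF assms(1), symmetric] by auto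
  also have "\<dots> = skip p ` occurrences n (delete_pair n p \<tau>) i"
    by (intro arg_cong[where f = "image (skip p)"]) (auto simp: occurrences_def delete_pair_def)
  finally show ?thesis .
qed

text \<open>The increasing map \<open>skip p\<close> preserves the sizes of the sets of occurrences
  and the order of their maxima, so the conditions on old values agree on both sides. The
  equivalence serves both insertion and deletion.\<close>

lemma standard_deals_Suc_iff:
  assumes \<tau>: "\<tau> \<in> {1..2*Suc n} \<rightarrow>\<^sub>E {1..Suc n}"
    and p: "p \<in> {1..2*n+1}"
    and occ: "occurrences (Suc n) \<tau> (Suc n) = {p, 2*n+2}"
  shows "\<tau> \<in> standard_deals (Suc n) \<longleftrightarrow> delete_pair n p \<tau> \<in> standard_deals n"
proof -
  let ?\<sigma> = "delete_pair n p \<tau>"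
  let ?A = "occurrences (Suc n) \<tau>" and ?B = "occurrences n ?\<sigma>"
  have AB: "?A i = skip p ` ?B i" if "i \<in> {1..n}" for i
    using occurrences_delete_pair[OF p occ] that by auto
  have \<sigma>: "?\<sigma> \<in> {1..2*n} \<rightarrow>\<^sub>E {1..n}"
  proof (rule PiE_I)
    fix j assume j: "j \<in> {1..2*n}"
    then have "skip p j \<in> {1..2*n+1} - {p}" using skip_image[OF p] by blast
    then have "skip p j \<in> {1..2*Suc n}" "skip p j \<notin> ?A (Suc n)" unfolding occ by auto
    then have "\<tau> (skip p j) \<in> {1..Suc n}" "\<tau> (skip p j) \<noteq> Suc n"
      using \<tau> by (blast dest: PiE_mem, simp add: occurrences_def)
    then show "?\<sigma> j \<in> {1..n}" using j by (auto simp: delete_pair_def)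
  qed (auto simp: delete_pair_def)
  have card: "card (?A i) = card (?B i)" if "i \<in> {1..n}" for i
    unfolding AB[OF that]
    by (rule card_image) (meson strict_mono_skip strict_mono_imp_inj_on inj_on_subset subset_UNIV)
  have card_last: "card (?A (Suc n)) = 2" unfolding occ using p by auto
  have cards: "(\<forall>i\<in>{1..Suc n}. card (?A i) = 2) \<longleftrightarrow> (\<forall>i\<in>{1..n}. card (?B i) = 2)"
  proof -
    have "{1..Suc n} = insert (Suc n) {1..n}" by auto
    then show ?thesis using card card_last by (simp only: ball_simps) simp
  qed
  have Max: "Max (?A i) = skip p (Max (?B i))" if "i \<in> {1..n}" "card (?B i) = 2" for i
    unfolding AB[OF that(1)]
    by (rule mono_Max_commute[symmetric])
       (use that strict_mono_skip in \<open>auto simp: strict_mono_mono\<close>)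
  \<comment> \<open>The one new order condition: an old position is at most \<open>2*n\<close>, so
    it moves to at most \<open>2*n+1\<close>, short of the last position.\<close>
  have Max_last: "Max (?A n) < Max (?A (Suc n))" if "n \<ge> 1" "card (?B n) = 2"
  proof -
    have "Max (?B n) \<in> ?B n" by (rule Max_in) (use that in auto)
    then have "Max (?B n) \<le> 2*n" by (simp add: occurrences_def)
    then show ?thesis using Max[of n] that p unfolding occ by (simp add: skip_def)
  qed
  have order: "(\<forall>i\<in>{1..<Suc n}. Max (?A i) < Max (?A (i + 1))) \<longleftrightarrow>
      (\<forall>i\<in>{1..<n}. Max (?B i) < Max (?B (i + 1)))"
    if c: "\<forall>i\<in>{1..n}. card (?B i) = 2"
  proof -
    have iff: "Max (?A i) < Max (?A (i + 1)) \<longleftrightarrow> Max (?B i) < Max (?B (i + 1))"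
      if "i \<in> {1..<n}" for i
      using Max[of i] Max[of "i + 1"] c that strict_mono_less[OF strict_mono_skip] by simp
    show ?thesis
    \<comment> \<open>Passing to \<open>Suc n\<close> adds the single index \<open>n\<close>; for
      \<open>n = 0\<close> both ranges are empty.\<close>
    proof (cases "n \<ge> 1")
      case True
      then have "{1..<Suc n} = insert n {1..<n}" by auto
      then show ?thesis using iff Max_last True c by (simp only: ball_simps) simp
    qed simp
  qed
  show ?thesis
    unfolding standard_deals_iff cards using \<tau> \<sigma> order by blast
qed

lemma insert_pair_skip:
  assumes "p \<in> {1..2*n+1}" "j \<in> {1..2*n}"
  shows "insert_pair n p \<sigma> (skip p j) = \<sigma> j"
  using assms by (auto simp: insert_pair_def skip_def)

lemma delete_insert_pair:
  assumes "p \<in> {1..2*n+1}" "\<sigma> \<in> {1..2*n} \<rightarrow>\<^sub>E B"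
  shows "delete_pair n p (insert_pair n p \<sigma>) = \<sigma>"
proof
  fix j
  show "delete_pair n p (insert_pair n p \<sigma>) j = \<sigma> j"
  proof (cases "j \<in> {1..2*n}")
    case True
    then show ?thesis using insert_pair_skip[OF assms(1)] by (simp add: delete_pair_def)
  next
    \<comment> \<open>Outside the domain both sides are \<open>undefined\<close>, by extensionality
      of \<open>\<sigma>\<close>.\<close>
    case False
    then show ?thesis
      using PiE_arb[OF assms(2) False] by (simp only: delete_pair_def restrict_apply if_False)
  qed
qed

lemma insert_pair_PiE:
  assumes "p \<in> {1..2*n+1}" "\<sigma> \<in> {1..2*n} \<rightarrow>\<^sub>E {1..n}"
  shows "insert_pair n p \<sigma> \<in> {1..2*Suc n} \<rightarrow>\<^sub>E {1..Suc n}"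
proof (rule PiE_I)
  fix j assume j: "j \<in> {1..2*Suc n}"
  then consider "j = p \<or> j = 2*n+2" | "j \<in> {1..2*n+1} - {p}" by force
  then show "insert_pair n p \<sigma> j \<in> {1..Suc n}"
  proof cases
    case 1
    then show ?thesis using j by (auto simp: insert_pair_def)
  next
    case 2
    then obtain k where "k \<in> {1..2*n}" "j = skip p k"
      unfolding skip_image[OF assms(1), symmetric] by blast
    then show ?thesis using insert_pair_skip[OF assms(1)] PiE_mem[OF assms(2)] by fastforce
  qed
qed (auto simp: insert_pair_def)

text \<open>Cards coming from \<open>\<sigma>\<close> are at most \<open>n\<close>, so only the two
  inserted ones qualify. This makes \<open>p\<close> recoverable from the new deal.\<close>

lemma occurrences_insert_pair:
  assumes "p \<in> {1..2*n+1}" "\<sigma> \<in> {1..2*n} \<rightarrow>\<^sub>E {1..n}"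
  shows "occurrences (Suc n) (insert_pair n p \<sigma>) (Suc n) = {p, 2*n+2}"
proof -
  have "\<sigma> k \<noteq> Suc n" if "k \<in> {1..2*n}" for k
    using PiE_mem[OF assms(2) that] by auto
  then have ne: "insert_pair n p \<sigma> j \<noteq> Suc n" if "j \<in> {1..2*n+1} - {p}" for j
    using that insert_pair_skip[OF assms(1)] unfolding skip_image[OF assms(1), symmetric] by auto
  show ?thesis
  proof (intro equalityI subsetI)
    fix j assume "j \<in> occurrences (Suc n) (insert_pair n p \<sigma>) (Suc n)"
    then have "j \<in> {1..2*Suc n}" "insert_pair n p \<sigma> j = Suc n" by (simp_all add: occurrences_def)
    moreover from this have "j \<notin> {1..2*n+1} - {p}" using ne by blast
    ultimately show "j \<in> {p, 2*n+2}" by auto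
  qed (use assms(1) in \<open>auto simp: occurrences_def insert_pair_def\<close>)
qed

lemma insert_pair_standard:
  assumes "p \<in> {1..2*n+1}" "\<sigma> \<in> standard_deals n"
  shows "insert_pair n p \<sigma> \<in> standard_deals (Suc n)"
proof -
  have \<sigma>: "\<sigma> \<in> {1..2*n} \<rightarrow>\<^sub>E {1..n}" using assms by (simp add: standard_deals_iff)
  show ?thesis
    using standard_deals_Suc_iff[OF insert_pair_PiE[OF assms(1) \<sigma>] assms(1)
        occurrences_insert_pair[OF assms(1) \<sigma>]] assms(2)
    by (simp add: delete_insert_pair[OF assms(1) \<sigma>])
qed

text \<open>Surjectivity of insertion: one copy of \<open>Suc n\<close> is last by
  \<open>last_card\<close>, \<open>p\<close> is the place of the other copy, and deleting both gives
  \<open>\<sigma>\<close>.\<close>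

lemma standard_deals_Suc_obtain:
  assumes "\<tau> \<in> standard_deals (Suc n)"
  obtains p \<sigma> where "p \<in> {1..2*n+1}" "\<sigma> \<in> standard_deals n" "\<tau> = insert_pair n p \<sigma>"
proof -
  let ?A = "occurrences (Suc n) \<tau> (Suc n)"
  have \<tau>: "\<tau> \<in> {1..2*Suc n} \<rightarrow>\<^sub>E {1..Suc n}" using assms by (simp add: standard_deals_iff)
  have "2*n+2 \<in> ?A" using last_card[OF assms] by (simp add: occurrences_def)
  moreover have "card ?A = 2" using assms by (simp add: standard_deals_iff)
  ultimately obtain p where occ: "?A = {p, 2*n+2}" and "p \<noteq> 2*n+2"
    by (auto simp: card_2_iff insert_commute)
  have "p \<in> ?A" using occ by simp
  then have p: "p \<in> {1..2*n+1}" using \<open>p \<noteq> 2*n+2\<close> by (simp add: occurrences_def)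
  have "\<tau> = insert_pair n p (delete_pair n p \<tau>)"
  proof
    fix j
    consider "j \<notin> {1..2*Suc n}" | "j = p \<or> j = 2*n+2" | "j \<in> {1..2*n+1} - {p}" by force
    then show "\<tau> j = insert_pair n p (delete_pair n p \<tau>) j"
    proof cases
      case 1
      then show ?thesis using PiE_arb[OF \<tau> 1] by (simp only: insert_pair_def restrict_apply if_False)
    next
      case 2
      then have "j \<in> ?A" unfolding occ by auto
      then show ?thesis using 2 by (auto simp: occurrences_def insert_pair_def)
    next
      case 3
      then obtain k where "k \<in> {1..2*n}" "j = skip p k" unfolding skip_image[OF p, symmetric] by auto
      then show ?thesis using insert_pair_skip[OF p] by (simp add: delete_pair_def)
    qed
  qed
  moreover have "delete_pair n p \<tau> \<in> standard_deals n"
    using standard_deals_Suc_iff[OF \<tau> p occ] assms by simp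
  ultimately show ?thesis using p that by blast
qed

text \<open>For injectivity, the occurrences of \<open>Suc n\<close> reveal \<open>p\<close>, and
  deletion at \<open>p\<close> then returns \<open>\<sigma>\<close>.\<close>

lemma bij_betw_insert_pair:
  "bij_betw (\<lambda>(p, \<sigma>). insert_pair n p \<sigma>) ({1..2*n+1} \<times> standard_deals n) (standard_deals (Suc n))"
  unfolding bij_betw_def
proof
  show "inj_on (\<lambda>(p, \<sigma>). insert_pair n p \<sigma>) ({1..2*n+1} \<times> standard_deals n)"
  proof (rule inj_onI, clarify)
    fix p q \<sigma> \<rho>
    assume p: "p \<in> {1..2*n+1}" and q: "q \<in> {1..2*n+1}"
      and "\<sigma> \<in> standard_deals n" "\<rho> \<in> standard_deals n"
      and eq: "insert_pair n p \<sigma> = insert_pair n q \<rho>"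
    then have \<sigma>: "\<sigma> \<in> {1..2*n} \<rightarrow>\<^sub>E {1..n}" and \<rho>: "\<rho> \<in> {1..2*n} \<rightarrow>\<^sub>E {1..n}"
      by (auto simp: standard_deals_iff)
    have "{p, 2*n+2} = {q, 2*n+2}"
      using occurrences_insert_pair[OF p \<sigma>] occurrences_insert_pair[OF q \<rho>] eq by simp
    then have "p = q" using p q by (auto simp: doubleton_eq_iff)
    moreover from this have "\<sigma> = \<rho>"
      using delete_insert_pair[OF p \<sigma>] delete_insert_pair[OF q \<rho>] eq by metis
    ultimately show "p = q \<and> \<sigma> = \<rho>" by blast
  qed
  show "(\<lambda>(p, \<sigma>). insert_pair n p \<sigma>) ` ({1..2*n+1} \<times> standard_deals n) = standard_deals (Suc n)"
    by (auto intro: insert_pair_standard elim!: standard_deals_Suc_obtain)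
qed

section \<open>The first match under insertion\<close>

lemma first_match_props:
  assumes "n \<ge> 1" "\<sigma> \<in> standard_deals n"
  shows "first_match n \<sigma> \<in> {1..2*n}"
    and "\<exists>i\<in>{1..<first_match n \<sigma>}. \<sigma> (first_match n \<sigma>) = \<sigma> i"
  using LeastI_ex[OF first_match_exists[OF assms], folded first_match_def] by blast+

text \<open>The inserted pair is completed only at the very end, after every old match; all other
  matches are old ones moved by the increasing map \<open>skip p\<close>.\<close>

lemma first_match_insert_pair:
  assumes "n \<ge> 1" "\<sigma> \<in> standard_deals n" and p: "p \<in> {1..2*n+1}"
  shows "first_match (Suc n) (insert_pair n p \<sigma>) = skip p (first_match n \<sigma>)"
proof -
  let ?\<tau> = "insert_pair n p \<sigma>" and ?f = "first_match n \<sigma>"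
  note f = first_match_props[OF assms(1,2)]
  have \<sigma>: "\<sigma> \<in> {1..2*n} \<rightarrow>\<^sub>E {1..n}" using assms by (simp add: standard_deals_iff)
  have sk: "skip p j \<in> {1..2*n+1} - {p}" if "j \<in> {1..2*n}" for j
    using that skip_image[OF p] by blast
  show ?thesis
    unfolding first_match_def[of "Suc n"]
  proof (rule Least_equality)
    obtain i where i: "i \<in> {1..<?f}" "\<sigma> ?f = \<sigma> i" using f by blast
    then have "i \<in> {1..2*n}" using f by auto
    then have "skip p i \<in> {1..<skip p ?f}" "?\<tau> (skip p ?f) = ?\<tau> (skip p i)"
      using sk[of i] i f(1) insert_pair_skip[OF p] strict_mono_less[OF strict_mono_skip, of p i ?f]
      by auto
    then show "skip p ?f \<in> {1..2*Suc n} \<and> (\<exists>i\<in>{1..<skip p ?f}. ?\<tau> (skip p ?f) = ?\<tau> i)"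
      using sk[OF f(1)] by auto
  next
    fix j assume "j \<in> {1..2*Suc n} \<and> (\<exists>i\<in>{1..<j}. ?\<tau> j = ?\<tau> i)"
    then obtain i where j: "j \<in> {1..2*Suc n}" and i: "i \<in> {1..<j}" "?\<tau> j = ?\<tau> i" by blast
    show "skip p ?f \<le> j"
    proof (cases "?\<tau> j = Suc n")
      \<comment> \<open>Two positions \<open>i < j\<close> holding \<open>Suc n\<close> must be
        \<open>p\<close> and \<open>2*n+2\<close>, so \<open>j\<close> is last.\<close>
      case True
      then have "{i, j} \<subseteq> {p, 2*n+2}"
        using i j occurrences_insert_pair[OF p \<sigma>, symmetric] by (auto simp: occurrences_def)
      then have "j = 2*n+2" using i p by auto
      then show ?thesis using sk[OF f(1)] by auto
    next
      \<comment> \<open>Both positions lie in the range of \<open>skip p\<close>, so the match pulls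
        back to a match \<open>a < b\<close> in \<open>\<sigma>\<close>.\<close>
      case False
      have last: "?\<tau> p = Suc n" "?\<tau> (2*n+2) = Suc n" using p by (auto simp: insert_pair_def)
      have "j \<noteq> p" "j \<noteq> 2*n+2" "i \<noteq> p" "i \<noteq> 2*n+2"
        using False i(2) last by metis+
      then have "i \<in> {1..2*n+1} - {p}" "j \<in> {1..2*n+1} - {p}" using i j by auto
      then obtain a b where a: "a \<in> {1..2*n}" "i = skip p a" and b: "b \<in> {1..2*n}" "j = skip p b"
        unfolding skip_image[OF p, symmetric] by blast
      have "a < b" using i a b strict_mono_less[OF strict_mono_skip] by auto
      moreover have "\<sigma> b = \<sigma> a" using i(2) a b insert_pair_skip[OF p] by simp
      ultimately have "?f \<le> b"
        unfolding first_match_def by (intro Least_le) (use a b in auto)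
      then show ?thesis using b strict_mono_less_eq[OF strict_mono_skip] by simp
    qed
  qed
qed

section \<open>The recursion for the expectation, and Wallis' product\<close>

lemma card_standard_deals_Suc: "card (standard_deals (Suc n)) = (2*n+1) * card (standard_deals n)"
  using bij_betw_same_card[OF bij_betw_insert_pair[of n]] by (simp add: card_cartesian_product)

lemma sum_first_match_Suc:
  assumes "n \<ge> 1"
  shows "(\<Sum>\<sigma>\<in>standard_deals (Suc n). first_match (Suc n) \<sigma>) =
         (2*n+2) * (\<Sum>\<sigma>\<in>standard_deals n. first_match n \<sigma>)"
proof -
  have "(\<Sum>\<sigma>\<in>standard_deals (Suc n). first_match (Suc n) \<sigma>) =
      (\<Sum>(p, \<sigma>)\<in>{1..2*n+1} \<times> standard_deals n. first_match (Suc n) (insert_pair n p \<sigma>))"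
    by (subst sum.reindex_bij_betw[OF bij_betw_insert_pair, symmetric]) (simp add: case_prod_unfold)
  also have "\<dots> = (\<Sum>(p, \<sigma>)\<in>{1..2*n+1} \<times> standard_deals n. skip p (first_match n \<sigma>))"
    using first_match_insert_pair[OF assms] by (intro sum.cong) auto
  also have "\<dots> = (\<Sum>\<sigma>\<in>standard_deals n. \<Sum>p\<in>{1..2*n+1}. skip p (first_match n \<sigma>))"
    by (subst sum.swap) (simp add: sum.cartesian_product)
  \<comment> \<open>For fixed \<open>\<sigma>\<close>, \<open>sum_skip\<close> with
    \<open>m = 2*n+1\<close> yields the factor \<open>2*n+2\<close>.\<close>
  also have "\<dots> = (\<Sum>\<sigma>\<in>standard_deals n. (2*n+2) * first_match n \<sigma>)"
  proof (rule sum.cong)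
    fix \<sigma> assume "\<sigma> \<in> standard_deals n"
    then have "first_match n \<sigma> \<le> 2*n+1" using first_match_props(1)[OF assms] by force
    from sum_skip[OF this] show
      "(\<Sum>p\<in>{1..2*n+1}. skip p (first_match n \<sigma>)) = (2*n+2) * first_match n \<sigma>" by simp
  qed simp
  finally show ?thesis by (simp add: sum_distrib_left)
qed

lemma expected_first_match_eq:
  "expected_first_match n =
     real (\<Sum>\<sigma>\<in>standard_deals n. first_match n \<sigma>) / real (card (standard_deals n))"
  unfolding expected_first_match_def
  by (subst integral_pmf_of_set) (simp_all add: standard_deals_nonempty finite_standard_deals)

lemma expected_first_match_1: "expected_first_match 1 = 2"
proof -
  \<comment> \<open>The match is at position 1 or 2 and has a position to its left.\<close>
  have "first_match 1 \<sigma> = 2" if "\<sigma> \<in> standard_deals 1" for \<sigma>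
    using first_match_props[OF _ that] by auto
  then show ?thesis
    using standard_deals_nonempty[of 1] finite_standard_deals[of 1]
    by (simp add: expected_first_match_eq)
qed

lemma expected_first_match_Suc:
  assumes "n \<ge> 1"
  shows "expected_first_match (Suc n) = (2 * n + 2) / (2 * n + 1) * expected_first_match n"
  unfolding expected_first_match_eq sum_first_match_Suc[OF assms] card_standard_deals_Suc
  by (simp only: of_nat_mult of_nat_add of_nat_numeral of_nat_1 times_divide_times_eq)

text \<open>With \<open>a = 2*n+1\<close>, \<open>b = 2*n+3\<close>, \<open>c = 2*n+2\<close>, the
  squared ratio of consecutive expectations is \<open>(c/a)^2 = (b/a) * (c^2/(a*b))\<close>. The
  first factor turns the prefactor \<open>a\<close> into \<open>b\<close>; the second is the next
  Wallis factor, since \<open>a*b = c^2 - 1\<close>.\<close>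

lemma expected_first_match_square:
  assumes "n \<ge> 1"
  shows "(expected_first_match n)\<^sup>2 = (2 * n + 1) * (\<Prod>k=1..n. 4 * real k ^ 2 / (4 * real k ^ 2 - 1))"
  using assms
proof (induction n rule: dec_induct)
  case base
  then show ?case using expected_first_match_1 by simp
next
  case (step n)
  define x where "x = real n"
  have x: "x \<ge> 1" using step by (simp add: x_def)
  let ?P = "\<lambda>n. \<Prod>k=1..n. 4 * real k ^ 2 / (4 * real k ^ 2 - 1)"
  have factor: "(2 * x + 2)\<^sup>2 - 1 = (2 * x + 1) * (2 * x + 3)"
    by (simp add: power2_eq_square algebra_simps)
  have cancel: "(c / a)\<^sup>2 * a = b * (c\<^sup>2 / (a * b))" if "a > 0" "b > 0" for a b c :: real
    using that by (simp add: field_simps power2_eq_square)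
  have "(expected_first_match (Suc n))\<^sup>2 = ((2 * x + 2) / (2 * x + 1))\<^sup>2 * (2 * x + 1) * ?P n"
    unfolding expected_first_match_Suc[OF step.hyps(1)] power_mult_distrib step.IH x_def
    by (simp only: mult.assoc)
  also have "\<dots> = (2 * x + 3) * (?P n * ((2 * x + 2)\<^sup>2 / ((2 * x + 2)\<^sup>2 - 1)))"
    using cancel[of "2 * x + 1" "2 * x + 3" "2 * x + 2"] x unfolding factor by simp
  also have "(2 * x + 2)\<^sup>2 = 4 * (real (Suc n))\<^sup>2"
    by (simp add: x_def power2_eq_square algebra_simps)
  also have "?P n * (4 * (real (Suc n))\<^sup>2 / (4 * (real (Suc n))\<^sup>2 - 1)) = ?P (Suc n)"
    by (simp del: of_nat_Suc)
  finally show ?case by (simp add: x_def)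
qed

text \<open>Fixes the sign when the square root of the squared expectation is taken.\<close>

lemma expected_first_match_nonneg: "expected_first_match n \<ge> 0"
  unfolding expected_first_match_eq by (intro divide_nonneg_nonneg of_nat_0_le_iff)

theorem corollary6:
  shows "(\<lambda>n. expected_first_match n / sqrt (pi * real n)) \<longlonglongrightarrow> 1"
proof -
  let ?W = "\<lambda>n. \<Prod>k=1..n. 4 * real k ^ 2 / (4 * real k ^ 2 - 1)"
  have "(\<lambda>n. (2 * real n + 1) / (pi * real n)) \<longlonglongrightarrow> 2 / pi"
    by (real_asymp simp: divide_inverse)
  \<comment> \<open>Wallis' product tends to \<open>pi / 2\<close>, which cancels the limit
    \<open>2 / pi\<close>.\<close>
  from tendsto_real_sqrt[OF tendsto_mult[OF this wallis]]
  have "(\<lambda>n. sqrt ((2 * real n + 1) / (pi * real n) * ?W n)) \<longlonglongrightarrow> 1" by simp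
  \<comment> \<open>The formula for the square starts at \<open>n = 1\<close>, so the two sequences
    are identified eventually.\<close>
  moreover have "\<forall>\<^sub>F n in sequentially. sqrt ((2 * real n + 1) / (pi * real n) * ?W n) =
      expected_first_match n / sqrt (pi * real n)"
    using eventually_ge_at_top[of 1]
  proof eventually_elim
    case (elim n)
    have "sqrt ((2 * real n + 1) / (pi * real n) * ?W n) =
        sqrt ((expected_first_match n)\<^sup>2 / (pi * real n))"
      unfolding expected_first_match_square[OF elim] by simp
    then show ?case
      using expected_first_match_nonneg[of n] by (simp add: real_sqrt_divide)
  qed
  ultimately show ?thesis by (rule Lim_transform_eventually)
qed

end
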